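(* Let $G$ be an $m$-uniform $p$-hm bipartite hypergraph. Then $G$ is spectral $\frac{m}{\gcd(p,m)}$-symmetric.
   Context: An $m$-uniform hypergraph has vertex set $[n]$ and edges that are $m$-element subsets. $G$ is $p$-hm bipartite if its vertex set has a bipartition $V_1\cup V_2$ such that every edge contains exactly $p$ vertices of $V_1$. The adjacency tensor $\mathcal{A}(G)$ has entries $a_{i_1\ldots i_m}=\frac1{(m-1)!}$ if $\{i_1,\dots,i_m\}\in E(G)$ and $0$ otherwise. $\mathrm{Spec}$ of a tensor $\mathcal{A}$ is the multiset of roots of $\det(\lambda\mathcal{I}-\mathcal{A})$ (determinant = resultant of the polynomials $(\mathcal{B}x^{m-1})_i=\sum_{i_2,\dots,i_m}b_{ii_2\ldots i_m}x_{i_2}\cdots x_{i_m}$; $\mathcal{I}$ the identity tensor). $G$ is spectral $\ell$-symmetric if $\mathrm{Spec}(\mathcal{A}(G))=e^{\mathbf{i}2\pi/\ell}\mathrm{Spec}(\mathcal{A}(G))$. *)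

theory Defs
  imports
    Complex_Main
    "HOL-Library.Poly_Mapping"
    "HOL-Computational_Algebra.Computational_Algebra"
begin

section \<open>Hypergraphs on the vertex set \<open>[n] = {1..n}\<close>, given by their edge sets\<close>

definition uniform_hypergraph :: "nat \<Rightarrow> nat \<Rightarrow> nat set set \<Rightarrow> bool" where
  "uniform_hypergraph m n E \<longleftrightarrow> (\<forall>e\<in>E. e \<subseteq> {1..n} \<and> card e = m)"

definition hm_bipartite :: "nat \<Rightarrow> nat \<Rightarrow> nat set set \<Rightarrow> bool" where
  "hm_bipartite p n E \<longleftrightarrow>
     (\<exists>V1 V2. V1 \<union> V2 = {1..n} \<and> V1 \<inter> V2 = {} \<and> (\<forall>e\<in>E. card (e \<inter> V1) = p))"


section \<open>Multivariate polynomials\<close>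

text \<open>
  A polynomial in variables of type \<open>'v\<close> is a finitely supported map from exponent vectors
  (monomials) to coefficients; \<open>mpoly_eval h x f\<close> is the value at the point \<open>x\<close> after mapping
  the coefficients along \<open>h\<close>.
\<close>

type_synonym 'v monomial = "'v \<Rightarrow>\<^sub>0 nat"
type_synonym ('v, 'a) mpoly = "('v \<Rightarrow>\<^sub>0 nat) \<Rightarrow>\<^sub>0 'a"

definition mpoly_eval ::
  "('a::zero \<Rightarrow> 'b::comm_semiring_1) \<Rightarrow> ('v \<Rightarrow> 'b) \<Rightarrow> ('v, 'a) mpoly \<Rightarrow> 'b" where
  "mpoly_eval h x f =
     (\<Sum>\<alpha>\<in>Poly_Mapping.keys f. h (Poly_Mapping.lookup f \<alpha>) *
        (\<Prod>v\<in>Poly_Mapping.keys \<alpha>. x v ^ Poly_Mapping.lookup \<alpha> v))"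

definition monomials :: "nat \<Rightarrow> nat \<Rightarrow> nat monomial set" where
  "monomials n d =
     {\<alpha>. Poly_Mapping.keys \<alpha> \<subseteq> {1..n} \<and> (\<Sum>v\<in>Poly_Mapping.keys \<alpha>. Poly_Mapping.lookup \<alpha> v) = d}"

definition is_form :: "nat \<Rightarrow> nat \<Rightarrow> (nat, 'a::zero) mpoly \<Rightarrow> bool" where
  "is_form n d f \<longleftrightarrow> Poly_Mapping.keys f \<subseteq> monomials n d"


section \<open>The resultant of \<open>n\<close> forms of degree \<open>d\<close> in \<open>n\<close> variables\<close>

text \<open>
  The resultant is an integer polynomial in indeterminates \<open>u\<^sub>i\<^sub>,\<^sub>\<alpha>\<close>, indexed here by pairs
  \<open>(i, \<alpha>)\<close>, one for each coefficient of the generic forms \<open>F\<^sub>i = \<Sum>\<^sub>\<alpha> u\<^sub>i\<^sub>,\<^sub>\<alpha> x\<^sup>\<alpha>\<close>.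
  Its value at concrete forms is obtained by substituting their coefficients.
\<close>

type_synonym res_poly = "(nat \<times> nat monomial, int) mpoly"

definition res_value ::
  "res_poly \<Rightarrow> (nat \<Rightarrow> (nat, 'a::comm_ring_1) mpoly) \<Rightarrow> 'a" where
  "res_value R F = mpoly_eval of_int (\<lambda>(i, \<alpha>). Poly_Mapping.lookup (F i) \<alpha>) R"

text \<open>
  The standard defining properties (see e.g. Cox, Little, O'Shea, Using Algebraic Geometry,
  Chapter 3, or Gelfand, Kapranov, Zelevinsky): the resultant is irreducible, vanishes
  exactly on the systems having a nontrivial common zero, and has the value \<open>1\<close> at
  \<open>x\<^sub>1\<^sup>d, \<dots>, x\<^sub>n\<^sup>d\<close>.
\<close>

definition is_resultant :: "nat \<Rightarrow> nat \<Rightarrow> res_poly \<Rightarrow> bool" where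
  "is_resultant n d R \<longleftrightarrow>
     (\<forall>\<mu>\<in>Poly_Mapping.keys R. Poly_Mapping.keys \<mu> \<subseteq> {1..n} \<times> monomials n d) \<and>
     irreducible R \<and>
     (\<forall>F :: nat \<Rightarrow> (nat, complex) mpoly. (\<forall>i\<in>{1..n}. is_form n d (F i)) \<longrightarrow>
        (res_value R F = 0 \<longleftrightarrow>
         (\<exists>x :: nat \<Rightarrow> complex. (\<exists>i\<in>{1..n}. x i \<noteq> 0) \<and>
            (\<forall>i\<in>{1..n}. mpoly_eval (\<lambda>c. c) x (F i) = 0)))) \<and>
     res_value R (\<lambda>i. Poly_Mapping.single (Poly_Mapping.single i d) (1::complex)) = 1"

text \<open>
  By a classical theorem exactly one such polynomial exists for all \<open>n, d \<ge> 1\<close>, so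
  that the resultant is that polynomial; the value \<open>0\<close> is only the
  convention for degenerate parameters (\<open>n = 0\<close>, or \<open>d = 0\<close> and \<open>n \<ge> 2\<close>), where there is none.
\<close>

definition resultant_poly :: "nat \<Rightarrow> nat \<Rightarrow> res_poly" where
  "resultant_poly n d =
     (if \<exists>!R. is_resultant n d R then THE R. is_resultant n d R else 0)"


section \<open>Tensors of order \<open>m\<close> and dimension \<open>n\<close>\<close>

text \<open>
  The entry \<open>a\<close> with indices \<open>i\<^sub>1, \<dots>, i\<^sub>m \<in> {1..n}\<close> is \<open>A [i\<^sub>1, \<dots>, i\<^sub>m]\<close>; values on other lists
  are irrelevant.
\<close>

type_synonym 'a tensor = "nat list \<Rightarrow> 'a"

definition identity_tensor :: "'a::zero_neq_one tensor" where
  "identity_tensor is = (if \<forall>i\<in>set is. \<forall>j\<in>set is. i = j then 1 else 0)"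

definition adjacency_tensor :: "nat \<Rightarrow> nat set set \<Rightarrow> complex tensor" where
  "adjacency_tensor m E is = (if set is \<in> E then 1 / fact (m - 1) else 0)"

text \<open>\<open>(B x\<^sup>m\<^sup>-\<^sup>1)\<^sub>i\<close> as a polynomial in \<open>x\<^sub>1, \<dots>, x\<^sub>n\<close>\<close>

definition tensor_form ::
  "nat \<Rightarrow> nat \<Rightarrow> 'a::comm_ring_1 tensor \<Rightarrow> nat \<Rightarrow> (nat, 'a) mpoly" where
  "tensor_form m n B i =
     (\<Sum>js | set js \<subseteq> {1..n} \<and> length js = m - 1.
        Poly_Mapping.single (\<Sum>j\<leftarrow>js. Poly_Mapping.single j 1) (B (i # js)))"

definition tensor_det :: "nat \<Rightarrow> nat \<Rightarrow> 'a::comm_ring_1 tensor \<Rightarrow> 'a" where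
  "tensor_det m n B = res_value (resultant_poly n (m - 1)) (tensor_form m n B)"

text \<open>\<open>det (\<lambda>I - A)\<close>, the determinant being taken over the polynomial ring in \<open>\<lambda>\<close>\<close>

definition tensor_charpoly :: "nat \<Rightarrow> nat \<Rightarrow> complex tensor \<Rightarrow> complex poly" where
  "tensor_charpoly m n A =
     tensor_det m n (\<lambda>is. [:0, 1:] * identity_tensor is - [:A is:])"

definition Spec :: "nat \<Rightarrow> nat \<Rightarrow> complex tensor \<Rightarrow> complex multiset" where
  "Spec m n A = proots (tensor_charpoly m n A)"

definition spectral_symmetric :: "nat \<Rightarrow> nat \<Rightarrow> nat \<Rightarrow> nat set set \<Rightarrow> bool" where
  "spectral_symmetric l m n E \<longleftrightarrow>
     Spec m n (adjacency_tensor m E) =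
     image_mset (\<lambda>z. exp (\<i> * 2 * of_real pi / of_nat l) * z) (Spec m n (adjacency_tensor m E))"

end

theory Submission
  imports Defs
begin

text \<open>
  Let \<open>\<epsilon> = exp (2\<pi>\<i> / l)\<close>, where \<open>l = m div gcd p m\<close>. Rescaling the coordinates in \<open>V\<^sub>1\<close> and the
  equations by powers of \<open>t\<close> gives a one-parameter family \<open>B\<^sub>t\<close> of tensors that starts at
  \<open>\<lambda>I - A\<close> for \<open>t = 1\<close> and, by the bipartition condition, reaches \<open>\<epsilon>\<lambda>I - A\<close> at a suitable root
  of unity \<open>t\<close>. The rescaling does not affect the solvability of the system for \<open>t \<noteq> 0\<close>, so
  that \<open>det B\<^sub>t\<close>, a polynomial in \<open>t\<close> and \<open>\<lambda>\<close>, has for each \<open>\<lambda>\<close> either no zero \<open>t \<noteq> 0\<close> or only zeros.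
  Such a polynomial is \<open>t\<^sup>K\<close> times its value at \<open>t = 1\<close>. Hence the characteristic polynomial
  \<open>\<phi>\<close> satisfies \<open>\<phi>(\<epsilon>\<lambda>) = c \<phi>(\<lambda>)\<close> with \<open>c \<noteq> 0\<close>. Of the resultant only the vanishing criterion
  is used.
\<close>

section \<open>Polynomials without nonzero roots\<close>

text \<open>After the full power of the variable is split off, the cofactor has no root at all, so
  it is constant by the fundamental theorem of algebra.\<close>

lemma complex_poly_without_nonzero_roots:
  fixes q :: "complex poly"
  assumes "\<And>t. t \<noteq> 0 \<Longrightarrow> poly q t \<noteq> 0"
  obtains c k where "q = monom c k"
proof -
  have "q \<noteq> 0"
    using assms[of 1] by auto
  then obtain r where r: "q = [:-0, 1:] ^ order 0 q * r" "\<not> [:-0, 1:] dvd r"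
    using order_decomp by blast
  have "poly r t \<noteq> 0" for t
  proof (cases "t = 0")
    case True
    then show ?thesis
      using r(2) by (metis poly_eq_0_iff_dvd)
  next
    case False
    then show ?thesis
      using assms[OF False] by (subst (asm) r(1)) auto
  qed
  then have "constant (poly r)"
    using fundamental_theorem_of_algebra by blast
  then obtain c where "r = [:c:]"
    by (metis constant_degree degree_eq_zeroE)
  then have "q = monom c (order 0 q)"
    using r(1) by (simp add: monom_altdef)
  then show thesis
    by (rule that)
qed

lemma poly_map_poly_eval:
  fixes P :: "'a::comm_ring_1 poly poly"
  shows "poly (map_poly (\<lambda>q. poly q a) P) t = poly (poly P [:t:]) a"
  by (induction P) (simp_all add: map_poly_pCons)

text \<open>The outer variable of \<open>P\<close> is t, the inner one \<lambda>. Wherever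
  \<open>poly P 1\<close> is nonzero at a, specialising \<lambda> to a leaves a monomial in t; its
  exponent turns out not to depend on a.\<close>

lemma poly_poly_homogeneous:
  fixes P :: "complex poly poly"
  assumes zeros: "\<And>t a. t \<noteq> 0 \<Longrightarrow> poly (poly P [:t:]) a = 0 \<longleftrightarrow> poly (poly P 1) a = 0"
  obtains K where "\<And>t a. t \<noteq> 0 \<Longrightarrow> poly (poly P [:t:]) a = t ^ K * poly (poly P 1) a"
proof (cases "poly P 1 = 0")
  case True
  then show thesis
    using zeros by (intro that[of 0]) simp
next
  case False
  have "j = k" if "coeff P j \<noteq> 0" "coeff P k \<noteq> 0" for j k
  proof -
    \<comment> \<open>At a point a where none of the three factors vanishes, the specialised
      polynomial is a monomial in t, yet its coefficients at j and k are both nonzero.\<close>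
    have "poly P 1 * coeff P j * coeff P k \<noteq> 0"
      using False that by simp
    then obtain a where a: "poly (poly P 1 * coeff P j * coeff P k) a \<noteq> 0"
      using poly_all_0_iff_0 by blast
    let ?q = "map_poly (\<lambda>q. poly q a) P"
    have "poly ?q t \<noteq> 0" if "t \<noteq> 0" for t
      using zeros[OF that] a by (simp add: poly_map_poly_eval)
    then obtain c i where "?q = monom c i"
      using complex_poly_without_nonzero_roots by blast
    then have "poly (coeff P l) a = (if i = l then c else 0)" for l
      by (metis coeff_map_poly coeff_monom poly_0)
    from this[of j] this[of k] show "j = k"
      using a by (auto split: if_splits)
  qed
  moreover obtain K where "coeff P K \<noteq> 0"
    using False by (metis leading_coeff_0_iff poly_0)
  ultimately have "P = monom (coeff P K) K"
    unfolding poly_eq_iff by (metis coeff_monom)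
  then have P: "poly P x = coeff P K * x ^ K" for x
    by (metis poly_monom)
  show thesis
    by (rule that[of K]) (simp add: P poly_power)
qed

text \<open>Substituting \<open>a / e\<close> into the splitting of a nonzero \<open>q\<close> shows
  that, up to a nonzero scalar, \<open>q\<close> is the product of the factors X - e x over its
  roots x. For \<open>q = 0\<close> both multisets are empty.\<close>

lemma image_mset_proots_rotate:
  fixes q :: "complex poly"
  assumes "e \<noteq> 0" "c \<noteq> 0" and rot: "\<And>a. poly q (e * a) = c * poly q a"
  shows "image_mset (\<lambda>z. e * z) (proots q) = proots q"
proof (cases "q = 0")
  case False
  let ?M = "proots q"
  have split: "poly q a = lead_coeff q * (\<Prod>x\<in>#?M. a - x)" for a
    by (subst complex_poly_decompose_multiset[symmetric]) (simp add: poly_prod_mset)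
  have "(\<Prod>x\<in>#M. a / e - x) = (\<Prod>x\<in>#M. a - e * x) / e ^ size M" for a M
    using \<open>e \<noteq> 0\<close> by (induction M) (simp_all add: field_simps)
  then have "poly q a = poly (smult (c * lead_coeff q / e ^ size ?M)
      (\<Prod>x\<in>#image_mset (\<lambda>z. e * z) ?M. [:-x, 1:])) a" for a
    using rot[of "a / e"] split[of "a / e"] \<open>e \<noteq> 0\<close>
    by (simp add: poly_prod_mset image_mset.compositionality o_def)
  then have q: "q = smult (c * lead_coeff q / e ^ size ?M)
      (\<Prod>x\<in>#image_mset (\<lambda>z. e * z) ?M. [:-x, 1:])"
    by (intro poly_ext)
  have "proots (\<Prod>x\<in>#M. [:-x, 1:]) = M" for M :: "complex multiset"
  proof (induction M)
    case (add x M)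
    have "[:-x, 1:] * (\<Prod>x\<in>#M. [:-x, 1:]) \<noteq> 0"
      unfolding mult_eq_0_iff by (auto simp: prod_mset_zero_iff)
    with add show ?case
      by (simp add: proots_mult del: mult_pCons_left)
  qed simp
  then show ?thesis
    using assms(1,2) False by (subst (2) q) (simp del: proots_prod_mset)
qed simp

section \<open>Evaluation of tensor forms\<close>

text \<open>The resultant has integer coefficients, so the determinant commutes with ring
  homomorphisms such as evaluation.\<close>

lemma poly_tensor_det:
  fixes B :: "'a::comm_ring_1 poly tensor"
  shows "poly (tensor_det m n B) a = tensor_det m n (\<lambda>is. poly (B is) a)"
proof -
  have "poly (Poly_Mapping.lookup (tensor_form m n B i) \<alpha>) a
      = Poly_Mapping.lookup (tensor_form m n (\<lambda>is. poly (B is) a) i) \<alpha>" for i \<alpha>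
    unfolding tensor_form_def
    by (auto simp: lookup_sum poly_sum lookup_single when_def intro!: sum.cong)
  then show ?thesis
    unfolding tensor_det_def res_value_def mpoly_eval_def
    by (auto simp: poly_sum poly_prod poly_power split_beta intro!: sum.cong prod.cong)
qed

lemma keys_single_sum_list:
  "Poly_Mapping.keys (\<Sum>j\<leftarrow>js. Poly_Mapping.single j (1::nat)) = set js"
proof (induction js)
  case (Cons j js)
  then show ?case
    by (auto simp: set_eq_iff in_keys_iff lookup_add lookup_single when_def simp del: One_nat_def)
qed simp

lemma prod_power_single_sum_list:
  fixes x :: "'v \<Rightarrow> 'a::comm_semiring_1"
  assumes "finite S" "set js \<subseteq> S"
  shows "(\<Prod>v\<in>S. x v ^ Poly_Mapping.lookup (\<Sum>j\<leftarrow>js. Poly_Mapping.single j 1) v)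
    = (\<Prod>j\<leftarrow>js. x j)"
  using assms(2)
proof (induction js)
  case (Cons j js)
  have "(\<Prod>v\<in>S. x v ^ (1 when j = v)) = x j"
    using Cons.prems assms(1)
    by (subst prod.remove[of S j]) (auto simp: when_def prod.neutral)
  then show ?case
    using Cons by (simp add: lookup_add lookup_single power_add prod.distrib)
qed simp

lemma sum_lookup_single_sum_list:
  assumes "finite S" "set js \<subseteq> S"
  shows "(\<Sum>v\<in>S. Poly_Mapping.lookup (\<Sum>j\<leftarrow>js. Poly_Mapping.single j (1::nat)) v) = length js"
  using assms(2)
proof (induction js)
  case (Cons j js)
  have "(\<Sum>v\<in>S. (1 when j = v)) = (1::nat)"
    using Cons.prems assms(1) by (simp add: when_def)
  then show ?case
    using Cons by (simp add: lookup_add lookup_single sum.distrib)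
qed simp

text \<open>The vanishing criterion in \<open>is_resultant\<close> speaks of forms only.\<close>

lemma is_form_tensor_form:
  "is_form n (m - 1) (tensor_form m n B i)"
proof -
  have "(\<Sum>j\<leftarrow>js. Poly_Mapping.single j 1) \<in> monomials n (m - 1)"
    if "set js \<subseteq> {1..n}" "length js = m - 1" for js
    using that sum_lookup_single_sum_list[of "set js" js]
    by (simp add: monomials_def keys_single_sum_list del: One_nat_def)
  then show ?thesis
    unfolding is_form_def tensor_form_def
    by (intro order_trans[OF keys_sum] UN_least) (auto split: if_splits)
qed

text \<open>Supports can shrink under addition; a common finite superset allows termwise
  comparison.\<close>

lemma mpoly_eval_superset:
  assumes "finite M" "Poly_Mapping.keys f \<subseteq> M"
  shows "mpoly_eval (\<lambda>c. c) x f
    = (\<Sum>\<alpha>\<in>M. Poly_Mapping.lookup f \<alpha> * (\<Prod>v\<in>Poly_Mapping.keys \<alpha>. x v ^ Poly_Mapping.lookup \<alpha> v))"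
  unfolding mpoly_eval_def
  using assms by (intro sum.mono_neutral_left) (auto simp: in_keys_iff)

lemma mpoly_eval_add:
  "mpoly_eval (\<lambda>c. c) x (f + g) = mpoly_eval (\<lambda>c. c) x f + mpoly_eval (\<lambda>c. c) x g"
proof -
  let ?M = "Poly_Mapping.keys f \<union> Poly_Mapping.keys g"
  have "Poly_Mapping.keys (f + g) \<subseteq> ?M"
    by (rule Poly_Mapping.keys_add)
  then show ?thesis
    by (simp add: mpoly_eval_superset[of ?M] lookup_add distrib_right sum.distrib)
qed

lemma mpoly_eval_sum:
  "mpoly_eval (\<lambda>c. c) x (sum f A) = (\<Sum>a\<in>A. mpoly_eval (\<lambda>c. c) x (f a))"
  by (induction A rule: infinite_finite_induct) (simp_all add: mpoly_eval_add, simp_all add: mpoly_eval_def)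

lemma mpoly_eval_single:
  "mpoly_eval (\<lambda>c. c) x (Poly_Mapping.single \<alpha> c)
    = c * (\<Prod>v\<in>Poly_Mapping.keys \<alpha>. x v ^ Poly_Mapping.lookup \<alpha> v)"
  by (simp add: mpoly_eval_superset[of "{\<alpha>}"])

lemma mpoly_eval_tensor_form:
  "mpoly_eval (\<lambda>c. c) x (tensor_form m n B i)
    = (\<Sum>js | set js \<subseteq> {1..n} \<and> length js = m - 1. B (i # js) * (\<Prod>j\<leftarrow>js. x j))"
  unfolding tensor_form_def mpoly_eval_sum mpoly_eval_single keys_single_sum_list
  by (simp add: prod_power_single_sum_list del: One_nat_def)

lemma tensor_form_cong:
  assumes "m \<ge> 1" "\<And>is. length is = m \<Longrightarrow> B is = B' is"
  shows "tensor_form m n B = tensor_form m n B'"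
  unfolding tensor_form_def using assms by (intro ext sum.cong) auto

section \<open>Rescaled tensors\<close>

text \<open>Exponent of t in an entry of \<open>B_t\<close>: the first index accounts for the factor
  of its equation, the others for the scaling of the coordinates, and \<open>g\<close> for a factor
  common to all equations.\<close>

definition weight :: "nat \<Rightarrow> nat \<Rightarrow> 'v set \<Rightarrow> 'v list \<Rightarrow> nat" where
  "weight g s V is = g + s * length (filter (\<lambda>v. v \<in> V) is)"

text \<open>Scaling the coordinates in \<open>V\<close> by \<open>t ^ s\<close> permutes the nonzero
  vectors, and each equation only gains a nonzero factor.\<close>

lemma tensor_det_rescale_eq_0_iff:
  fixes B :: "complex tensor" and t :: complex
  assumes R: "is_resultant n (m - 1) (resultant_poly n (m - 1))" and "t \<noteq> 0"
  shows "tensor_det m n (\<lambda>is. t ^ weight g s V is * B is) = 0 \<longleftrightarrow> tensor_det m n B = 0"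
proof -
  let ?solvable = "\<lambda>B. \<exists>x :: nat \<Rightarrow> complex. (\<exists>i\<in>{1..n}. x i \<noteq> 0) \<and>
      (\<forall>i\<in>{1..n}. mpoly_eval (\<lambda>c. c) x (tensor_form m n B i) = 0)"
  let ?B = "\<lambda>is. t ^ weight g s V is * B is"
  let ?d = "\<lambda>i. if i \<in> V then t ^ s else 1"
  have vanish: "tensor_det m n B = 0 \<longleftrightarrow> ?solvable B" for B
    using R is_form_tensor_form unfolding is_resultant_def tensor_det_def by blast
  have prod: "(\<Prod>j\<leftarrow>js. ?d j * x j) = t ^ (s * length (filter (\<lambda>v. v \<in> V) js)) * (\<Prod>j\<leftarrow>js. x j)"
    for x js
    by (induction js) (auto simp: power_add)
  have eval: "mpoly_eval (\<lambda>c. c) x (tensor_form m n ?B i)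
      = t ^ g * ?d i * mpoly_eval (\<lambda>c. c) (\<lambda>j. ?d j * x j) (tensor_form m n B i)" for x i
    unfolding mpoly_eval_tensor_form prod sum_distrib_left
    by (intro sum.cong) (auto simp: weight_def power_add algebra_simps)
  have d: "?d i \<noteq> 0" for i
    using \<open>t \<noteq> 0\<close> by simp
  have "?solvable ?B \<longleftrightarrow> ?solvable B"
  proof
    assume "?solvable ?B"
    then obtain x where x: "\<exists>i\<in>{1..n}. x i \<noteq> 0"
      "\<forall>i\<in>{1..n}. mpoly_eval (\<lambda>c. c) x (tensor_form m n ?B i) = 0"
      by blast
    with d \<open>t \<noteq> 0\<close> show "?solvable B"
      by (intro exI[of _ "\<lambda>j. ?d j * x j"]) (simp add: eval)
  next
    assume "?solvable B"
    then obtain x where x: "\<exists>i\<in>{1..n}. x i \<noteq> 0"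
      "\<forall>i\<in>{1..n}. mpoly_eval (\<lambda>c. c) x (tensor_form m n B i) = 0"
      by blast
    have "(\<lambda>j. ?d j * (x j / ?d j)) = x"
      using d by auto
    with x d show "?solvable ?B"
      by (intro exI[of _ "\<lambda>j. x j / ?d j"]) (simp only: eval, simp)
  qed
  then show ?thesis
    by (simp only: vanish)
qed

lemma tensor_det_rescale:
  assumes R: "is_resultant n (m - 1) (resultant_poly n (m - 1))"
  obtains K where "\<And>t a. t \<noteq> 0 \<Longrightarrow>
    tensor_det m n (\<lambda>is. t ^ weight g s V is * (a * identity_tensor is - A is))
      = t ^ K * poly (tensor_charpoly m n A) a"
proof -
  \<comment> \<open>This is det \<open>B_t\<close> with outer variable t and inner variable
    \<lambda>.\<close>
  define P where "P = tensor_det m n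
    (\<lambda>is. monom 1 (weight g s V is) * [: [:0, 1:] * identity_tensor is - [:A is:] :])"
  have id: "poly (identity_tensor is) a = identity_tensor is" for a :: complex and "is"
    by (simp add: identity_tensor_def)
  have P: "poly (poly P [:t:]) a =
      tensor_det m n (\<lambda>is. t ^ weight g s V is * (a * identity_tensor is - A is))" for t a
    unfolding P_def poly_tensor_det by (simp add: poly_monom poly_power id algebra_simps)
  have P1: "poly (poly P 1) a = tensor_det m n (\<lambda>is. a * identity_tensor is - A is)" for a
    using P[of 1 a] by (simp flip: one_pCons)
  have "poly (poly P 1) a = poly (tensor_charpoly m n A) a" for a
    unfolding P1 tensor_charpoly_def poly_tensor_det by (simp add: id)
  moreover have "poly (poly P [:t:]) a = 0 \<longleftrightarrow> poly (poly P 1) a = 0" if "t \<noteq> 0" for t a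
    unfolding P P1 using tensor_det_rescale_eq_0_iff[OF R that] .
  ultimately show thesis
    using poly_poly_homogeneous[of P] that P by metis
qed

section \<open>The spectrum of a bipartite hypergraph\<close>

text \<open>As \<open>0\<close> is the default value, any other value certifies unique
  existence.\<close>

lemma is_resultant_resultant_poly:
  assumes "resultant_poly n d \<noteq> 0"
  shows "is_resultant n d (resultant_poly n d)"
proof -
  have "\<exists>!R. is_resultant n d R"
    using assms by (auto simp only: resultant_poly_def split: if_splits)
  then show ?thesis
    by (simp only: resultant_poly_def if_True) (rule theI')
qed

lemma length_filter_edge:
  assumes "card (set is) = length is"
  shows "length (filter (\<lambda>v. v \<in> V) is) = card (set is \<inter> V)"
  using assms
  by (metis Collect_conj_eq Collect_mem_eq card_distinct distinct_card distinct_filter set_filter)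

text \<open>On an edge the weight is \<open>s * p + g\<close>, a multiple of \<open>m\<close>, and
  the identity tensor vanishes. On the diagonal the weight is \<open>g\<close> or
  \<open>g + s * m\<close>, which gives \<open>z ^ g\<close>. All other entries are zero on both
  sides.\<close>

lemma rescaled_characteristic_tensor:
  fixes a z :: complex
  assumes unif: "uniform_hypergraph m n E" and p: "\<forall>e\<in>E. card (e \<inter> V) = p"
    and "m \<ge> 2" "z ^ m = 1" "m dvd s * p + g" "length is = m"
  shows "z ^ weight g s V is * (a * identity_tensor is - adjacency_tensor m E is)
    = z ^ g * a * identity_tensor is - adjacency_tensor m E is"
proof (cases "set is \<in> E")
  case True
  with unif have card: "card (set is) = m"
    by (auto simp: uniform_hypergraph_def)
  have "identity_tensor is = (0::complex)"
  proof (rule ccontr)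
    assume "identity_tensor is \<noteq> (0::complex)"
    then have "\<forall>i\<in>set is. \<forall>j\<in>set is. i = j"
      by (auto simp: identity_tensor_def split: if_splits)
    then have "card (set is) \<le> 1"
      by (simp add: card_le_Suc0_iff_eq)
    with card \<open>m \<ge> 2\<close> show False by simp
  qed
  moreover have "weight g s V is = s * p + g"
    using True p card assms(6) by (simp add: weight_def length_filter_edge)
  then have "z ^ weight g s V is = 1"
    using assms(4,5) by (metis dvdE power_mult power_one)
  ultimately show ?thesis by simp
next
  case False
  have "z ^ weight g s V is = z ^ g" if "\<forall>i\<in>set is. \<forall>j\<in>set is. i = j"
  proof -
    from that have "filter (\<lambda>v. v \<in> V) is = is \<or> filter (\<lambda>v. v \<in> V) is = []"
      by (auto simp: filter_empty_conv filter_id_conv)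
    with assms(4,6) show ?thesis
      by (auto simp: weight_def power_add power_mult mult.commute[of s])
  qed
  with False show ?thesis
    by (auto simp: adjacency_tensor_def identity_tensor_def)
qed

theorem theorem4p5:
  fixes m n p :: nat and E :: "nat set set"
  assumes "uniform_hypergraph m n E"
    and "hm_bipartite p n E"
  shows "spectral_symmetric (m div gcd p m) m n E"
proof -
  let ?A = "adjacency_tensor m E"
  let ?g = "gcd p m"
  define e where "e = exp (\<i> * 2 * of_real pi / of_nat (m div ?g))"
  consider "m \<le> 1" | "resultant_poly n (m - 1) = 0"
    | "m \<ge> 2" "is_resultant n (m - 1) (resultant_poly n (m - 1))"
    using is_resultant_resultant_poly[of n "m - 1"] by fastforce
  then have "image_mset (\<lambda>z. e * z) (Spec m n ?A) = Spec m n ?A"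
  proof cases
    case 1
    then have "m = 0 \<or> m = 1" by auto
    \<comment> \<open>For \<open>m = 0\<close> the quotient is 0 and division by zero makes the
      exponent 0; for \<open>m = 1\<close> it is a full turn.\<close>
    then have "e = 1"
      using exp_two_pi_i by (auto simp: e_def mult_ac)
    then show ?thesis by simp
  next
    case 2
    \<comment> \<open>The characteristic polynomial is then 0, and its \<open>proots\<close> are
      empty.\<close>
    then show ?thesis
      by (simp add: Spec_def tensor_charpoly_def tensor_det_def res_value_def mpoly_eval_def)
  next
    case 3
    obtain V where V: "\<forall>e\<in>E. card (e \<inter> V) = p"
      using assms(2) by (auto simp: hm_bipartite_def)
    \<comment> \<open>Bezout with this sign makes \<open>s * p\<close> congruent to minus the gcd
      modulo \<open>m\<close>, which cancels the common exponent \<open>g\<close> on edges but not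
      on the diagonal.\<close>
    obtain r s where "m * r = p * s + gcd m p"
      using bezout_nat[of m p] 3 by auto
    then have s: "m dvd s * p + ?g"
      by (metis dvd_triv_left gcd.commute mult.commute)
    define z where "z = exp (\<i> * 2 * of_real pi / of_nat m)"
    have "z ^ m = exp (of_nat m * (\<i> * 2 * of_real pi / of_nat m))"
      by (simp only: z_def exp_of_nat_mult)
    also have "\<dots> = 1"
      using 3 exp_two_pi_i by (simp add: mult_ac)
    finally have z: "z ^ m = 1" .
    have "z ^ ?g = exp (of_nat ?g * (\<i> * 2 * of_real pi / of_nat m))"
      by (simp only: z_def exp_of_nat_mult)
    also have "of_nat m = (of_nat (m div ?g) * of_nat ?g :: complex)"
      by (metis dvd_div_mult_self gcd_dvd2 of_nat_mult)
    finally have zg: "z ^ ?g = e"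
      using 3 by (simp add: e_def)
    obtain K where K: "\<And>t a. t \<noteq> 0 \<Longrightarrow>
      tensor_det m n (\<lambda>is. t ^ weight ?g s V is * (a * identity_tensor is - ?A is))
        = t ^ K * poly (tensor_charpoly m n ?A) a"
      using tensor_det_rescale[OF 3(2)] by blast
    have "poly (tensor_charpoly m n ?A) (e * a) = z ^ K * poly (tensor_charpoly m n ?A) a" for a
    proof -
      \<comment> \<open>The trivial factor \<open>1 ^ weight ?g s V is\<close> lets \<open>K\<close>
        apply at t = 1.\<close>
      have "poly (tensor_charpoly m n ?A) (e * a)
          = tensor_det m n (\<lambda>is. 1 ^ weight ?g s V is * (e * a * identity_tensor is - ?A is))"
        by (subst K) simp_all
      also have "\<dots> = tensor_det m n (\<lambda>is. z ^ weight ?g s V is * (a * identity_tensor is - ?A is))"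
        unfolding tensor_det_def
        using 3(1) rescaled_characteristic_tensor[OF assms(1) V 3(1) z s, of _ a]
        by (subst tensor_form_cong) (simp_all add: zg)
      also have "\<dots> = z ^ K * poly (tensor_charpoly m n ?A) a"
        by (rule K) (simp add: z_def)
      finally show ?thesis .
    qed
    then show ?thesis
      unfolding Spec_def by (intro image_mset_proots_rotate[where c = "z ^ K"]) (simp_all add: e_def z_def)
  qed
  then show ?thesis
    by (simp add: spectral_symmetric_def e_def)
qed

end
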